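(* Let $A$ be a unital associative algebra over a field $k$, $E$ a $k$-vector space containing $A$ as a subspace and $\ast$ a unital associative algebra structure on $E$ such that $A$ is a subalgebra of $(E,\ast)$. Then there exist an algebra extending structure $\Omega(A,V)=(\triangleleft,\triangleright,\leftharpoonup,\rightharpoonup,f,\cdot)$ of $A$ through a subspace $V$ of $E$ (a complement of $A$ in $E$) and an isomorphism of algebras $(E,\ast)\cong A\ltimes V$ that stabilizes $A$ and co-stabilizes $V$.
   Context: All vector spaces, linear and bilinear maps are over an arbitrary field $k$. "Algebra" means unital associative $k$-algebra; subalgebras contain the unit and algebra maps preserve units. An extending datum of $A$ through a vector space $V$ is a system $\Omega(A,V)=(\triangleleft,\triangleright,\leftharpoonup,\rightharpoonup,f,\cdot)$ of six bilinear maps $\triangleleft:V\times A\to V$, $\triangleright:V\times A\to A$, $\leftharpoonup:A\times V\to A$, $\rightharpoonup:A\times V\to V$, $f:V\times V\to A$, $\cdot:V\times V\to V$. Let $A\ltimes V$ be the vector space $A\times V$ with multiplication $$(a,x)\bullet(b,y)=\bigl(ab+a\leftharpoonup y+x\triangleright b+f(x,y),\ a\rightharpoonup y+x\triangleleft b+x\cdot y\bigr).$$ If this multiplication is associative with unit $(1_A,0_V)$, then $\Omega(A,V)$ is called an algebra extending structure of $A$ through $V$ and $A\ltimes V$ the associated unified product. Let $V$ be a complement of $A$ in $E$ and $\pi:E=A\oplus V\to V$ the canonical projection. An isomorphism $\varphi:A\ltimes V\to E$ stabilizes $A$ if $\varphi(a,0)=a$ for all $a\in A$, and co-stabilizes $V$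 if $\pi(\varphi(a,x))=x$ for all $a\in A$, $x\in V$. *)

theory Defs
  imports "HOL-Analysis.Product_Vector"
begin

text \<open>
  Ambient vector spaces are types with a scalar multiplication (locale \<^locale>\<open>vector_space\<close>), and
  the algebras and vector spaces under study live on subspaces of them. Maps between such subspaces
  are total HOL functions; their values outside the carrier are irrelevant.
\<close>

section \<open>Linear and bilinear maps between subspaces\<close>

definition linear_on ::
  "('k \<Rightarrow> 'u::plus \<Rightarrow> 'u) \<Rightarrow> ('k \<Rightarrow> 'w::plus \<Rightarrow> 'w) \<Rightarrow> 'u set \<Rightarrow> 'w set \<Rightarrow> ('u \<Rightarrow> 'w) \<Rightarrow> bool" where
  "linear_on sU sW U W h \<longleftrightarrow>
     (\<forall>x\<in>U. h x \<in> W) \<and>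
     (\<forall>x\<in>U. \<forall>y\<in>U. h (x + y) = h x + h y) \<and>
     (\<forall>c. \<forall>x\<in>U. h (sU c x) = sW c (h x))"

definition bilinear_on ::
  "('k \<Rightarrow> 'u::plus \<Rightarrow> 'u) \<Rightarrow> ('k \<Rightarrow> 'v::plus \<Rightarrow> 'v) \<Rightarrow> ('k \<Rightarrow> 'w::plus \<Rightarrow> 'w) \<Rightarrow>
     'u set \<Rightarrow> 'v set \<Rightarrow> 'w set \<Rightarrow> ('u \<Rightarrow> 'v \<Rightarrow> 'w) \<Rightarrow> bool" where
  "bilinear_on sU sV sW U V W h \<longleftrightarrow>
     (\<forall>x\<in>U. linear_on sV sW V W (\<lambda>y. h x y)) \<and>
     (\<forall>y\<in>V. linear_on sU sW U W (\<lambda>x. h x y))"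

section \<open>Unital associative algebras\<close>

definition assoc_on :: "'a set \<Rightarrow> ('a \<Rightarrow> 'a \<Rightarrow> 'a) \<Rightarrow> bool" where
  "assoc_on A m \<longleftrightarrow> (\<forall>a\<in>A. \<forall>b\<in>A. \<forall>c\<in>A. m (m a b) c = m a (m b c))"

definition unit_on :: "'a set \<Rightarrow> ('a \<Rightarrow> 'a \<Rightarrow> 'a) \<Rightarrow> 'a \<Rightarrow> bool" where
  "unit_on A m u \<longleftrightarrow> u \<in> A \<and> (\<forall>a\<in>A. m u a = a \<and> m a u = a)"

locale algebra_on = vector_space scale
  for scale :: "'k::field \<Rightarrow> 'a::ab_group_add \<Rightarrow> 'a" +
  fixes A :: "'a set" and m :: "'a \<Rightarrow> 'a \<Rightarrow> 'a" and u :: 'a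
  assumes subspace_carrier: "subspace A"
    and bilinear_mult: "bilinear_on scale scale scale A A A m"
    and assoc_mult: "assoc_on A m"
    and unit_mult: "unit_on A m u"

definition is_subalgebra ::
  "('k::field \<Rightarrow> 'a::ab_group_add \<Rightarrow> 'a) \<Rightarrow> 'a set \<Rightarrow> ('a \<Rightarrow> 'a \<Rightarrow> 'a) \<Rightarrow> 'a \<Rightarrow>
     'a set \<Rightarrow> ('a \<Rightarrow> 'a \<Rightarrow> 'a) \<Rightarrow> 'a \<Rightarrow> bool" where
  "is_subalgebra s A mA uA E m u \<longleftrightarrow>
     algebra_on s A mA uA \<and> algebra_on s E m u \<and>
     A \<subseteq> E \<and> uA = u \<and> (\<forall>a\<in>A. \<forall>b\<in>A. mA a b = m a b)"

definition algebra_iso ::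
  "('k::field \<Rightarrow> 'a::ab_group_add \<Rightarrow> 'a) \<Rightarrow> 'a set \<Rightarrow> ('a \<Rightarrow> 'a \<Rightarrow> 'a) \<Rightarrow> 'a \<Rightarrow>
   ('k \<Rightarrow> 'b::ab_group_add \<Rightarrow> 'b) \<Rightarrow> 'b set \<Rightarrow> ('b \<Rightarrow> 'b \<Rightarrow> 'b) \<Rightarrow> 'b \<Rightarrow> ('a \<Rightarrow> 'b) \<Rightarrow> bool" where
  "algebra_iso sA A mA uA sB B mB uB \<phi> \<longleftrightarrow>
     algebra_on sA A mA uA \<and> algebra_on sB B mB uB \<and>
     bij_betw \<phi> A B \<and> linear_on sA sB A B \<phi> \<and>
     (\<forall>x\<in>A. \<forall>y\<in>A. \<phi> (mA x y) = mB (\<phi> x) (\<phi> y)) \<and> \<phi> uA = uB"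

section \<open>Extending data and unified products\<close>

record ('a, 'v) ext_maps =
  lhd_map :: "'v \<Rightarrow> 'a \<Rightarrow> 'v" (infixl "\<lhd>\<index>" 70)
  rhd_map :: "'v \<Rightarrow> 'a \<Rightarrow> 'a" (infixl "\<rhd>\<index>" 70)
  lharp_map :: "'a \<Rightarrow> 'v \<Rightarrow> 'a" (infixl "\<leftharpoonup>\<index>" 70)
  rharp_map :: "'a \<Rightarrow> 'v \<Rightarrow> 'v" (infixl "\<rightharpoonup>\<index>" 70)
  cocycle :: "'v \<Rightarrow> 'v \<Rightarrow> 'a"
  vmult :: "'v \<Rightarrow> 'v \<Rightarrow> 'v" (infixl "\<cdot>\<index>" 70)

definition unified_mult ::
  "('a::plus \<Rightarrow> 'a \<Rightarrow> 'a) \<Rightarrow> ('a, 'v::plus) ext_maps \<Rightarrow> 'a \<times> 'v \<Rightarrow> 'a \<times> 'v \<Rightarrow> 'a \<times> 'v" where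
  "unified_mult m \<Omega> = (\<lambda>(a, x) (b, y).
     (m a b + a \<leftharpoonup>\<^bsub>\<Omega>\<^esub> y + x \<rhd>\<^bsub>\<Omega>\<^esub> b + cocycle \<Omega> x y,
      a \<rightharpoonup>\<^bsub>\<Omega>\<^esub> y + x \<lhd>\<^bsub>\<Omega>\<^esub> b + x \<cdot>\<^bsub>\<Omega>\<^esub> y))"

locale extending_datum =
  A: algebra_on sA A m u + V: vector_space sV
  for sA :: "'k::field \<Rightarrow> 'a::ab_group_add \<Rightarrow> 'a" and A m u
    and sV :: "'k \<Rightarrow> 'v::ab_group_add \<Rightarrow> 'v" +
  fixes V :: "'v set" and \<Omega> :: "('a, 'v) ext_maps" (structure)
  assumes subspace_V: "V.subspace V"
    and bilinear_lhd: "bilinear_on sV sA sV V A V (\<lambda>x a. x \<lhd> a)"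
    and bilinear_rhd: "bilinear_on sV sA sA V A A (\<lambda>x a. x \<rhd> a)"
    and bilinear_lharp: "bilinear_on sA sV sA A V A (\<lambda>a x. a \<leftharpoonup> x)"
    and bilinear_rharp: "bilinear_on sA sV sV A V V (\<lambda>a x. a \<rightharpoonup> x)"
    and bilinear_cocycle: "bilinear_on sV sV sA V V A (cocycle \<Omega>)"
    and bilinear_vmult: "bilinear_on sV sV sV V V V (\<lambda>x y. x \<cdot> y)"

locale algebra_extending_structure = extending_datum +
  assumes assoc_unified: "assoc_on (A \<times> V) (unified_mult m \<Omega>)"
    and unit_unified: "unit_on (A \<times> V) (unified_mult m \<Omega>) (u, 0)"

section \<open>Complements and projections\<close>

definition is_complement ::
  "('k::field \<Rightarrow> 'e::ab_group_add \<Rightarrow> 'e) \<Rightarrow> 'e set \<Rightarrow> 'e set \<Rightarrow> 'e set \<Rightarrow> bool" where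
  "is_complement s E A V \<longleftrightarrow>
     module.subspace s A \<and> module.subspace s V \<and>
     {a + x | a x. a \<in> A \<and> x \<in> V} = E \<and> A \<inter> V = {0}"

text \<open>The projection onto \<open>V\<close> along \<open>A\<close>; meaningful on \<open>A \<oplus> V\<close> when the sum is direct.\<close>

definition proj_along :: "'e::plus set \<Rightarrow> 'e set \<Rightarrow> 'e \<Rightarrow> 'e" where
  "proj_along A V e = (THE x. x \<in> V \<and> (\<exists>a\<in>A. e = a + x))"

definition stabilizes :: "'e set \<Rightarrow> ('e \<times> 'v::zero \<Rightarrow> 'e) \<Rightarrow> bool" where
  "stabilizes A \<phi> \<longleftrightarrow> (\<forall>a\<in>A. \<phi> (a, 0) = a)"

definition co_stabilizes :: "'e::plus set \<Rightarrow> 'e set \<Rightarrow> ('e \<times> 'e \<Rightarrow> 'e) \<Rightarrow> bool" where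
  "co_stabilizes A V \<phi> \<longleftrightarrow> (\<forall>a\<in>A. \<forall>x\<in>V. proj_along A V (\<phi> (a, x)) = x)"

end

theory Submission
  imports Defs
begin

text \<open>
  A linear retraction \<open>p\<close> of \<open>E\<close> onto \<open>A\<close> has a complement \<open>V\<close> of \<open>A\<close> as its kernel. Splitting the
  products \<open>x * a\<close>, \<open>a * x\<close>, \<open>x * y\<close> for \<open>a \<in> A\<close> and \<open>x, y \<in> V\<close> into their components along \<open>A\<close>
  and \<open>V\<close> gives the six maps of the extending datum. By bilinearity the linear bijection
  \<open>(a, x) \<mapsto> a + x\<close> is then multiplicative, so associativity and unitality of the unified product
  are pulled back from \<open>E\<close>.
\<close>

lemma bilinear_on_compose:
  assumes "bilinear_on sU sV sW U V W h" and "linear_on sW sZ W Z g"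
  shows "bilinear_on sU sV sZ U V Z (\<lambda>x y. g (h x y))"
  using assms unfolding bilinear_on_def linear_on_def by auto

lemma bilinear_on_subset:
  assumes "bilinear_on sU sV sW U V W h" and "U' \<subseteq> U" and "V' \<subseteq> V"
  shows "bilinear_on sU sV sW U' V' W h"
  using assms unfolding bilinear_on_def linear_on_def by (meson subsetD)

text \<open>Every algebra axiom is an equation between elements of \<open>A\<close>. Applying
  \<open>\<phi>\<close> turns it into the same axiom in \<open>B\<close>, and injectivity brings it
  back.\<close>

lemma algebra_on_pullback:
  assumes B: "algebra_on sB B mB uB"
    and "vector_space sA" and sub: "module.subspace sA A"
    and lin: "linear_on sA sB A B \<phi>" and inj: "inj_on \<phi> A"
    and closed: "\<And>x y. x \<in> A \<Longrightarrow> y \<in> A \<Longrightarrow> mA x y \<in> A"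
    and mult: "\<And>x y. x \<in> A \<Longrightarrow> y \<in> A \<Longrightarrow> \<phi> (mA x y) = mB (\<phi> x) (\<phi> y)"
    and "uA \<in> A" and "\<phi> uA = uB"
  shows "algebra_on sA A mA uA"
proof -
  interpret B: algebra_on sB B mB uB by fact
  interpret A: vector_space sA by fact
  note [simp] = closed mult \<open>uA \<in> A\<close> \<open>\<phi> uA = uB\<close>
  have [simp]: "\<phi> x \<in> B" "\<phi> (sA c x) = sB c (\<phi> x)" "sA c x \<in> A" if "x \<in> A" for x c
    using that lin sub unfolding linear_on_def by (auto intro: A.subspace_scale)
  have [simp]: "\<phi> (x + y) = \<phi> x + \<phi> y" "x + y \<in> A" if "x \<in> A" "y \<in> A" for x y
    using that lin sub unfolding linear_on_def
    by (auto intro: A.subspace_add)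
  note bil = B.bilinear_mult[unfolded bilinear_on_def linear_on_def]
  have [simp]: "mB (x + y) z = mB x z + mB y z" "mB z (x + y) = mB z x + mB z y"
    if "x \<in> B" "y \<in> B" "z \<in> B" for x y z
    using bil that by auto
  have [simp]: "mB (sB c x) y = sB c (mB x y)" "mB x (sB c y) = sB c (mB x y)" "mB x y \<in> B"
    if "x \<in> B" "y \<in> B" for x y c
    using bil that by auto
  have eqI: "x = y" if "\<phi> x = \<phi> y" "x \<in> A" "y \<in> A" for x y
    using inj that by (auto dest: inj_onD)
  show ?thesis
  proof
    show "A.subspace A" by (fact sub)
    show "bilinear_on sA sA sA A A A mA"
      unfolding bilinear_on_def linear_on_def by (auto intro!: eqI)
    show "assoc_on A mA"
      using B.assoc_mult unfolding assoc_on_def by (auto intro!: eqI)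
    show "unit_on A mA uA"
      using B.unit_mult unfolding unit_on_def by (auto intro!: eqI)
  qed
qed

text \<open>Makes the definite description in \<open>proj_along\<close> computable: for two
  decompositions of one vector, the difference of the \<open>V\<close>-parts equals a difference of
  \<open>A\<close>-parts, so it lies in \<open>A \<inter> V = {0}\<close>.\<close>

lemma proj_along_eq:
  fixes scale :: "'k::field \<Rightarrow> 'e::ab_group_add \<Rightarrow> 'e"
  assumes "vector_space scale" and "is_complement scale E A V" and "a \<in> A" and "x \<in> V"
  shows "proj_along A V (a + x) = x"
proof -
  interpret vector_space scale by fact
  have A: "subspace A" and V: "subspace V" and AV: "A \<inter> V = {0}"
    using assms(2) by (auto simp: is_complement_def)
  have "y = x" if "y \<in> V" "b \<in> A" "a + x = b + y" for b y
  proof -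
    have "y - x = a - b" using that(3) by (simp add: algebra_simps)
    then have "y - x \<in> A \<inter> V"
      using subspace_diff[OF A \<open>a \<in> A\<close> \<open>b \<in> A\<close>] subspace_diff[OF V \<open>y \<in> V\<close> \<open>x \<in> V\<close>] by simp
    then show ?thesis using AV by simp
  qed
  then show ?thesis
    using assms(3,4) unfolding proj_along_def by (intro the_equality) blast+
qed

theorem theorem1p4:
  fixes scale :: "'k::field \<Rightarrow> 'e::ab_group_add \<Rightarrow> 'e"
    and A :: "'e set"
    and multA mult :: "'e \<Rightarrow> 'e \<Rightarrow> 'e"
    and oneA one :: 'e
  assumes "vector_space scale"
    and "module.subspace scale A"
    and "algebra_on scale A multA oneA"
    and "algebra_on scale UNIV mult one"
    and "is_subalgebra scale A multA oneA UNIV mult one"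
  shows "\<exists>(V :: 'e set) (\<Omega> :: ('e, 'e) ext_maps) (\<phi> :: 'e \<times> 'e \<Rightarrow> 'e).
           is_complement scale UNIV A V \<and>
           algebra_extending_structure scale A multA oneA scale V \<Omega> \<and>
           algebra_iso (module_prod.scale scale scale) (A \<times> V) (unified_mult multA \<Omega>) (oneA, 0)
                       scale UNIV mult one \<phi> \<and>
           stabilizes A \<phi> \<and> co_stabilizes A V \<phi>"
proof -
  interpret vector_space scale by fact
  interpret EE: vector_space_pair scale scale ..
  interpret P: vector_space_prod scale scale ..
  interpret A: algebra_on scale A multA oneA by fact
  interpret E: algebra_on scale UNIV mult one by fact
  have one: "oneA = one" and multA: "\<And>a b. a \<in> A \<Longrightarrow> b \<in> A \<Longrightarrow> multA a b = mult a b"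
    using assms(5) by (auto simp: is_subalgebra_def)
  have add: "mult (x + y) z = mult x z + mult y z" "mult z (x + y) = mult z x + mult z y" for x y z
    using E.bilinear_mult by (auto simp: bilinear_on_def linear_on_def)
  \<comment> \<open>The retraction arises as a linear left inverse of the identity, which is
    injective on the subspace \<open>A\<close>.\<close>
  have "\<exists>g. range g \<subseteq> A \<and> Vector_Spaces.linear scale scale g \<and> (\<forall>v\<in>A. g (id v) = v)"
    by (intro EE.linear_exists_left_inverse_on assms(2) linear_id) auto
  then obtain p where p_in: "\<And>x. p x \<in> A" and p_lin: "Vector_Spaces.linear scale scale p"
    and p_A: "\<And>a. a \<in> A \<Longrightarrow> p a = a"
    by auto
  interpret p: Vector_Spaces.linear scale scale p by (fact p_lin)
  \<comment> \<open>The complementary projection, with values in \<open>V = ker p\<close> because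
    \<open>p\<close> is idempotent.\<close>
  define q where "q = (\<lambda>x. x - p x)"
  define V where "V = {x. p x = 0}"
  \<comment> \<open>Maps with values in \<open>A\<close> are \<open>p\<close> after
    \<open>mult\<close>, those with values in \<open>V\<close> are \<open>q\<close> after
    \<open>mult\<close>; maps with the same formula differ only in the carriers from which their
    arguments come.\<close>
  define \<Omega> :: "('e, 'e) ext_maps" where
    "\<Omega> = \<lparr>lhd_map = \<lambda>x y. q (mult x y), rhd_map = \<lambda>x y. p (mult x y),
          lharp_map = \<lambda>x y. p (mult x y), rharp_map = \<lambda>x y. q (mult x y),
          cocycle = \<lambda>x y. p (mult x y), vmult = \<lambda>x y. q (mult x y)\<rparr>"
  define \<phi> :: "'e \<times> 'e \<Rightarrow> 'e" where "\<phi> = (\<lambda>(a, x). a + x)"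
  have pq: "p x + q x = x" for x by (simp add: q_def)
  have q_in: "q x \<in> V" for x by (simp add: q_def V_def p.diff p_A p_in)
  have subV: "subspace V"
    unfolding V_def by (rule p.subspace_kernel)
  have compl: "is_complement scale UNIV A V"
    unfolding is_complement_def
  proof (intro conjI assms(2) subV)
    show "{a + x |a x. a \<in> A \<and> x \<in> V} = UNIV"
      using p_in q_in pq by (metis (mono_tags, lifting) UNIV_eq_I mem_Collect_eq)
    show "A \<inter> V = {0}"
      using p_A subspace_0[OF assms(2)] subspace_0[OF subV] by (auto simp: V_def)
  qed
  have p_on: "linear_on scale scale UNIV A p"
    by (simp add: linear_on_def p_in p.add p.scale)
  have q_on: "linear_on scale scale UNIV V q"
    unfolding linear_on_def using q_in
    by (auto simp: q_def p.add p.scale scale_right_diff_distrib)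
  \<comment> \<open>Leaving \<open>U\<close> and \<open>W\<close> arbitrary lets these two facts
    cover all six maps of the datum.\<close>
  have bil: "bilinear_on scale scale scale U W A (\<lambda>x y. p (mult x y))"
    "bilinear_on scale scale scale U W V (\<lambda>x y. q (mult x y))" for U W
    using bilinear_on_compose[OF bilinear_on_subset[OF E.bilinear_mult]] p_on q_on by auto
  have datum: "extending_datum scale A multA oneA scale V \<Omega>"
    by unfold_locales (simp_all add: \<Omega>_def bil subV)
  have AA: "mult a b \<in> A" if "a \<in> A" "b \<in> A" for a b
    using A.bilinear_mult that multA by (auto simp: bilinear_on_def linear_on_def)
  have closed: "unified_mult multA \<Omega> z w \<in> A \<times> V" if "z \<in> A \<times> V" "w \<in> A \<times> V" for z w
    using that
    by (auto simp: unified_mult_def \<Omega>_def multA AA p_in q_in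
        intro!: subspace_add[OF assms(2)] subspace_add[OF subV])
  have hom: "\<phi> (unified_mult multA \<Omega> z w) = mult (\<phi> z) (\<phi> w)" if "z \<in> A \<times> V" "w \<in> A \<times> V" for z w
  proof -
    obtain a x b y where [simp]: "z = (a, x)" "w = (b, y)" by (cases z, cases w)
    \<comment> \<open>\<open>\<phi>\<close> adds the two coordinates, which pairs each
      \<open>p\<close>-part with its \<open>q\<close>-part. The term \<open>mult a b\<close> stays
      whole, since it already lies in \<open>A\<close>. Once the pairs collapse by
      \<open>pq\<close>, the four terms are the expansion of the product of \<open>a + x\<close> and
      \<open>b + y\<close>.\<close>
    have "\<phi> (unified_mult multA \<Omega> z w) =
        mult a b + (p (mult a y) + q (mult a y)) + (p (mult x b) + q (mult x b))
          + (p (mult x y) + q (mult x y))"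
      using that by (simp add: \<phi>_def unified_mult_def \<Omega>_def multA)
    also have "\<dots> = mult (\<phi> z) (\<phi> w)"
      by (simp only: pq) (simp add: \<phi>_def add)
    finally show ?thesis .
  qed
  have lin: "linear_on P.scale scale (A \<times> V) UNIV \<phi>"
    by (auto simp: linear_on_def \<phi>_def P.scale_def scale_right_distrib)
  have p_\<phi>: "p (\<phi> (a, x)) = a" and q_\<phi>: "q (\<phi> (a, x)) = x" if "a \<in> A" "x \<in> V" for a x
    using that by (simp_all add: \<phi>_def q_def p.add p_A V_def)
  have \<phi>_pq: "\<phi> (p e, q e) = e" for e
    by (simp add: \<phi>_def pq)
  \<comment> \<open>The inverse sends a vector to its pair of components.\<close>
  have bij: "bij_betw \<phi> (A \<times> V) UNIV"
    by (rule bij_betw_byWitness[where f' = "\<lambda>e. (p e, q e)"])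
      (auto simp: p_in q_in \<phi>_pq p_\<phi> q_\<phi>)
  have unit: "(oneA, 0) \<in> A \<times> V" "\<phi> (oneA, 0) = one"
    using A.unit_mult subspace_0[OF subV] by (auto simp: unit_on_def \<phi>_def one)
  have "P.p.subspace (A \<times> V)"
    using assms(2) subV by (rule P.subspace_Times)
  \<comment> \<open>The algebra structure of \<open>E\<close> is pulled back along
    \<open>\<phi>\<close>. Its associativity and unit laws are exactly what turns the datum into an
    extending structure.\<close>
  then have alg: "algebra_on P.scale (A \<times> V) (unified_mult multA \<Omega>) (oneA, 0)"
    using algebra_on_pullback[OF assms(4) P.p.vector_space_axioms _ lin _ closed hom unit] bij
    by (simp add: bij_betw_def)
  have "algebra_extending_structure scale A multA oneA scale V \<Omega>"
    using datum algebra_on.assoc_mult[OF alg] algebra_on.unit_mult[OF alg]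
    by (simp add: algebra_extending_structure_def algebra_extending_structure_axioms_def)
  moreover have "algebra_iso P.scale (A \<times> V) (unified_mult multA \<Omega>) (oneA, 0)
      scale UNIV mult one \<phi>"
    using alg assms(4) bij lin hom unit by (simp add: algebra_iso_def)
  moreover have "stabilizes A \<phi>"
    by (simp add: stabilizes_def \<phi>_def)
  moreover have "co_stabilizes A V \<phi>"
    using proj_along_eq[OF assms(1) compl] by (simp add: co_stabilizes_def \<phi>_def)
  ultimately show ?thesis using compl by blast
qed

end
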